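(* Let $a>0$ and $b<a/2$ be real numbers. Let $(a_k)_{k\in\mathbb{Z}}$ and $(b_k)_{k\in\mathbb{Z}}$ be two finite (i.e. finitely supported) sequences of complex numbers and let $$u=\sum_{k\in\mathbb{Z}}a_k\chi_{[ak,ak+b)}\quad\text{and}\quad v=\sum_{k\in\mathbb{Z}}b_k\chi_{[ak,ak+b)}.$$ Let $\alpha\in\mathbb{R}\setminus\frac{\pi}{2}\mathbb{Z}$. If $|\mathcal{F}_\alpha v|=|\mathcal{F}_\alpha u|$, then there exists a constant $c\in\mathbb{C}$ with $|c|=1$ such that $v=cu$.
   Context: $\chi_E$ denotes the characteristic function of the set $E\subset\mathbb{R}$. Fractional Fourier transform on $\mathbb{R}$: for $\alpha\in\mathbb{R}\setminus\pi\mathbb{Z}$ put $c_\alpha=\frac{\exp\left(\frac{i}{2}\left(\alpha-\frac{\pi}{2}\right)\right)}{\sqrt{|\sin\alpha|}}$ and, for $u\in L^1(\mathbb{R})\cap L^2(\mathbb{R})$, $$\mathcal{F}_\alpha u(\xi)=c_\alpha e^{-i\pi \xi^2\cot\alpha}\int_{\mathbb{R}}u(t)e^{-i\pi t^2\cot\alpha}e^{-2i\pi t\xi/\sin\alpha}\,dt .$$ *)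

theory Defs
  imports "HOL-Analysis.Analysis"
begin

definition frft_const :: "real \<Rightarrow> complex" where
  "frft_const \<alpha> =
     exp (\<i> / 2 * (complex_of_real \<alpha> - complex_of_real pi / 2))
       / complex_of_real (sqrt \<bar>sin \<alpha>\<bar>)"

text \<open>The fractional Fourier transform. It is meaningful only for an angle that is not
  an integer multiple of \<open>\<pi>\<close> and for an integrable \<open>u\<close>; otherwise the value is an artefact
  of division by zero, or of the Bochner integral of a non-integrable function being zero.\<close>

definition frft :: "real \<Rightarrow> (real \<Rightarrow> complex) \<Rightarrow> real \<Rightarrow> complex" where
  "frft \<alpha> u \<xi> =
     frft_const \<alpha> * exp (- \<i> * complex_of_real (pi * \<xi>\<^sup>2 * cot \<alpha>)) *
     (LINT t|lborel. u t * exp (- \<i> * complex_of_real (pi * t\<^sup>2 * cot \<alpha>))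
                         * exp (- 2 * \<i> * complex_of_real (pi * t * \<xi> / sin \<alpha>)))"

text \<open>The sum over all integers \<open>k\<close> is taken over the support of \<open>s\<close>,
  which has to be finite for it not to be zero by convention.\<close>

definition pulse_train :: "real \<Rightarrow> real \<Rightarrow> (int \<Rightarrow> complex) \<Rightarrow> real \<Rightarrow> complex" where
  "pulse_train a b s x =
     (\<Sum>k | s k \<noteq> 0. s k * indicator {a * of_int k ..< a * of_int k + b} x)"

end

theory Submission imports Defs "HOL-Probability.Levy" begin

text \<open>
  The fractional transform at angle \<open>\<alpha>\<close> is, up to a nonzero constant, a unimodular factor and a
  dilation of the frequency, the ordinary Fourier transform of the chirped signal
  \<open>u t * cis (- \<kappa> * t\<^sup>2)\<close> with \<open>\<kappa> = pi * cot \<alpha>\<close>; the condition on \<open>\<alpha>\<close> makes \<open>\<kappa>\<close> finite and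
  nonzero. The squared modulus of a Fourier transform is the Fourier transform of the
  autocorrelation, and the Fourier transform is injective on integrable functions. So the
  hypothesis says exactly that the chirped signals have the same autocorrelation almost everywhere
  (lemma \<open>autocorr_eq_if_fourier_modulus_eq\<close>).

  For a pulse train, take a lag \<open>x = a * m + s\<close> with \<open>0 < s < b\<close>. A pulse shifted by such a lag
  meets exactly one pulse of the train, so only the products \<open>p (k + m) * cnj (p k)\<close> occur.
  Without the chirp their sum over \<open>k\<close> would be all that the autocorrelation reveals. The chirp
  turns the pair \<open>(k + m, k)\<close> by the angle \<open>- 2 * \<kappa> * a * x * k\<close>, which depends on the lag: the
  autocorrelation becomes a factor common to all pulse trains, times the Laurent polynomial in
  \<open>z = cis (- 2 * \<kappa> * a * x)\<close> whose \<open>k\<close>-th coefficient is \<open>p (k + m) * cnj (p k)\<close>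
  (lemma \<open>autocorr_chirped_pulse_train\<close>). The common factor does not vanish when \<open>s\<close> is close to
  \<open>b\<close>, and \<open>z\<close> then runs through infinitely many values, so every single product is determined
  (lemma \<open>coefficient_correlations_eq\<close>). Knowing all the products \<open>p j * cnj (p k)\<close> is knowing
  \<open>p\<close> up to a unimodular constant.
\<close>

section \<open>Injectivity of the Fourier transform\<close>

text \<open>The sign and the normalisation are those of characteristic functions of measures.\<close>

definition fourier :: "(real \<Rightarrow> complex) \<Rightarrow> real \<Rightarrow> complex" where
  "fourier f \<eta> = (LINT t|lborel. f t * cis (\<eta> * t))"

lemma borel_measurable_cis [measurable (raw)]:
  "g \<in> borel_measurable M \<Longrightarrow> (\<lambda>x. cis (g x)) \<in> borel_measurable M"
  unfolding cis_conv_exp by measurable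

lemma borel_measurable_cnj [measurable (raw)]:
  "g \<in> borel_measurable M \<Longrightarrow> (\<lambda>x. cnj (g x)) \<in> borel_measurable M"
  by (rule borel_measurable_continuous_on) (auto intro: continuous_intros)

lemma integrable_mult_cis:
  assumes f: "integrable M f" and [measurable]: "g \<in> borel_measurable M"
  shows "integrable M (\<lambda>x. f x * cis (g x))"
proof (rule Bochner_Integration.integrable_bound[OF f])
  have [measurable]: "f \<in> borel_measurable M"
    using f by simp
  show "(\<lambda>x. f x * cis (g x)) \<in> borel_measurable M"
    by measurable
qed (simp add: norm_mult)

text \<open>The positive and negative parts of \<open>f\<close> have the same Fourier transform and, at frequency zero,
  the same mass. Normalised, they are densities of two probability measures with the same
  characteristic function, which Levy's uniqueness theorem identifies.\<close>

lemma real_fourier_injective: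
  fixes f :: "real \<Rightarrow> real"
  assumes f: "integrable lborel f"
    and zero: "\<And>\<eta>. fourier (\<lambda>x. complex_of_real (f x)) \<eta> = 0"
  shows "AE x in lborel. f x = 0"
proof -
  define g where "g = (\<lambda>x. max (f x) 0)"
  define h where "h = (\<lambda>x. max (- f x) 0)"
  have g: "integrable lborel g" and h: "integrable lborel h"
    unfolding g_def h_def using f by (auto intro!: integrable_max)
  have [measurable]: "g \<in> borel_measurable lborel" "h \<in> borel_measurable lborel"
    using g h by auto
  have nonneg: "g x \<ge> 0" "h x \<ge> 0" for x
    by (auto simp: g_def h_def)
  have eq: "f x = g x - h x" for x
    by (auto simp: g_def h_def max_def)
  have fourier_eq: "(LINT x|lborel. g x *\<^sub>R iexp (\<eta> * x)) = (LINT x|lborel. h x *\<^sub>R iexp (\<eta> * x))" for \<eta>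
  proof -
    have "integrable lborel (\<lambda>x. complex_of_real (g x) * cis (\<eta> * x))"
      "integrable lborel (\<lambda>x. complex_of_real (h x) * cis (\<eta> * x))"
      using g h by (auto intro!: integrable_mult_cis)
    with zero[of \<eta>] show ?thesis
      by (simp add: fourier_def eq left_diff_distrib scaleR_conv_of_real cis_conv_exp)
  qed
  define c where "c = (LINT x|lborel. g x)"
  have c_eq: "c = (LINT x|lborel. h x)"
    using fourier_eq[of 0] by (simp add: c_def scaleR_conv_of_real)
  \<comment> \<open>Without mass there is nothing to normalise, but then both parts vanish almost everywhere.\<close>
  show ?thesis
  proof (cases "c = 0")
    case True
    have "AE x in lborel. g x = 0"
      using integral_nonneg_eq_0_iff_AE[OF g] nonneg True by (simp add: c_def)
    moreover have "AE x in lborel. h x = 0"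
      using integral_nonneg_eq_0_iff_AE[OF h] nonneg True c_eq by simp
    ultimately show ?thesis
      by eventually_elim (simp add: eq)
  next
    case False
    then have c: "c > 0"
      using Bochner_Integration.integral_nonneg[of lborel g] nonneg by (simp add: c_def order_less_le)
    define D where "D = (\<lambda>k::real \<Rightarrow> real. density lborel (\<lambda>x. ennreal (k x / c)))"
    have dist: "real_distribution (D k)"
      if k: "integrable lborel k" "\<And>x. k x \<ge> 0" "(LINT x|lborel. k x) = c" for k
    proof -
      have [measurable]: "k \<in> borel_measurable lborel" using k by auto
      have "(\<integral>\<^sup>+x. ennreal (k x / c) \<partial>lborel) = ennreal (LINT x|lborel. k x / c)"
        using k c by (intro nn_integral_eq_integral) auto
      then have "prob_space (D k)"
        using k c by (intro prob_spaceI) (simp add: D_def emeasure_density)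
      then show ?thesis
        by (simp add: real_distribution_def real_distribution_axioms_def D_def)
    qed
    have char: "char (D k) \<eta> = (LINT x|lborel. k x *\<^sub>R iexp (\<eta> * x)) / c"
      if k: "k \<in> borel_measurable lborel" "\<And>x. k x \<ge> 0" for k \<eta>
    proof -
      have "char (D k) \<eta> = (LINT x|lborel. (k x / c) *\<^sub>R iexp (\<eta> * x))"
        unfolding char_def D_def using k c by (subst integral_density) auto
      also have "\<dots> = (LINT x|lborel. (k x *\<^sub>R iexp (\<eta> * x)) / c)"
        by (intro Bochner_Integration.integral_cong) (auto simp: scaleR_conv_of_real)
      finally show ?thesis by simp
    qed
    have "D g = D h"
      using nonneg g h c_eq fourier_eq
      by (intro Levy_uniqueness dist ext) (auto simp: char c_def)
    then have "AE x in lborel. ennreal (g x / c) = ennreal (h x / c)"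
      unfolding D_def by (subst (asm) sigma_finite_measure.density_unique_iff) (auto intro: sigma_finite_lborel)
    then show ?thesis
    proof eventually_elim
      case (elim x)
      then have "g x / c = h x / c"
        using c nonneg by (subst (asm) ennreal_inj) auto
      with c show ?case by (simp add: eq)
    qed
  qed
qed

text \<open>A vanishing transform on the whole line is inherited by the complex conjugate, hence by the
  real and imaginary parts.\<close>

lemma fourier_injective:
  assumes f: "integrable lborel f" and zero: "\<And>\<eta>. fourier f \<eta> = 0"
  shows "AE x in lborel. f x = 0"
proof -
  have cnj_zero: "fourier (\<lambda>x. cnj (f x)) \<eta> = 0" for \<eta>
  proof -
    have "fourier (\<lambda>x. cnj (f x)) \<eta> = (LINT x|lborel. cnj (f x * cis (- \<eta> * x)))"
      by (simp add: fourier_def cis_cnj)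
    also have "\<dots> = cnj (fourier f (- \<eta>))"
      unfolding fourier_def by (rule Bochner_Integration.integral_cnj)
    finally show ?thesis
      by (simp add: zero)
  qed
  have int: "integrable lborel (\<lambda>x. f x * cis (\<eta> * x))" 
    "integrable lborel (\<lambda>x. cnj (f x) * cis (\<eta> * x))" for \<eta>
    using f by (auto intro!: integrable_mult_cis)
  have "fourier (\<lambda>x. complex_of_real (Re (f x))) \<eta> = (fourier f \<eta> + fourier (\<lambda>x. cnj (f x)) \<eta>) / 2" for \<eta>
  proof -
    have "complex_of_real (Re z) * w = (z * w + cnj z * w) / 2" for z w
      by (simp add: complex_add_cnj flip: distrib_right)
    then have "fourier (\<lambda>x. complex_of_real (Re (f x))) \<eta> =
      (LINT x|lborel. (f x * cis (\<eta> * x) + cnj (f x) * cis (\<eta> * x)) / 2)"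
      unfolding fourier_def by (simp only:)
    with int show ?thesis by (simp add: fourier_def)
  qed
  then have re: "AE x in lborel. Re (f x) = 0"
    using f by (intro real_fourier_injective) (auto simp: zero cnj_zero)
  have "fourier (\<lambda>x. complex_of_real (Im (f x))) \<eta> = (fourier f \<eta> - fourier (\<lambda>x. cnj (f x)) \<eta>) / (2 * \<i>)" for \<eta>
  proof -
    have "complex_of_real (Im z) = (z - cnj z) / (2 * \<i>)" for z
      by (simp add: complex_diff_cnj field_simps)
    then have "complex_of_real (Im z) * w = (z * w - cnj z * w) / (2 * \<i>)" for z w
      by (simp add: left_diff_distrib)
    then have "fourier (\<lambda>x. complex_of_real (Im (f x))) \<eta> =
      (LINT x|lborel. (f x * cis (\<eta> * x) - cnj (f x) * cis (\<eta> * x)) / (2 * \<i>))"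
      unfolding fourier_def by (simp only:)
    with int show ?thesis by (simp add: fourier_def)
  qed
  then have im: "AE x in lborel. Im (f x) = 0"
    using f by (intro real_fourier_injective) (auto simp: zero cnj_zero)
  from re im show ?thesis
    by eventually_elim (simp add: complex_eq_iff)
qed

section \<open>Autocorrelation and the modulus of the Fourier transform\<close>

definition autocorr :: "(real \<Rightarrow> complex) \<Rightarrow> real \<Rightarrow> complex" where
  "autocorr f x = (LINT t|lborel. f (t + x) * cnj (f t))"

text \<open>Tonelli: integrating the modulus first over \<open>x\<close> gives the \<open>L\<^sup>1\<close> norm of \<open>f\<close> times \<open>\<bar>f t\<bar>\<close>,
  by translation invariance.\<close>

lemma integrable_autocorr_kernel:
  fixes f :: "real \<Rightarrow> complex"
  assumes f: "integrable lborel f"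
  shows "integrable (lborel \<Otimes>\<^sub>M lborel) (\<lambda>(t, x). f (t + x) * cnj (f t))"
proof (rule lborel_pair.Fubini_integrable)
  have [measurable]: "f \<in> borel_measurable borel"
    using f by simp
  show "(\<lambda>(t, x). f (t + x) * cnj (f t)) \<in> borel_measurable (lborel \<Otimes>\<^sub>M lborel)"
    by measurable
  have shift: "integrable lborel (\<lambda>x. f (t + x))" for t
    using lborel_integrable_real_affine[OF f, of 1 t] by simp
  show "AE t in lborel. integrable lborel (\<lambda>x. case (t, x) of (t, x) \<Rightarrow> f (t + x) * cnj (f t))"
    using shift by simp
  have "(LINT x|lborel. norm (f (t + x) * cnj (f t))) = (LINT x|lborel. norm (f x)) * norm (f t)" for t
    using lborel_integral_real_affine[of 1 "\<lambda>x. norm (f x)" t] by (simp add: norm_mult)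
  then show "integrable lborel (\<lambda>t. LINT x|lborel. norm (case (t, x) of (t, x) \<Rightarrow> f (t + x) * cnj (f t)))"
    using f by simp
qed

lemma integrable_autocorr:
  assumes "integrable lborel f"
  shows "integrable lborel (autocorr f)"
  unfolding autocorr_def
  using lborel_pair.integrable_snd[OF integrable_autocorr_kernel[OF assms]] by simp

text \<open>Fubini, after writing \<open>cis (\<eta> * x)\<close> as \<open>cis (\<eta> * (t + x)) * cnj (cis (\<eta> * t))\<close>: the integral over
  \<open>x\<close> is then a translate of the one that defines \<open>fourier f \<eta>\<close>.\<close>

lemma fourier_autocorr:
  assumes f: "integrable lborel f"
  shows "fourier (autocorr f) \<eta> = of_real ((cmod (fourier f \<eta>))\<^sup>2)"
proof -
  have [measurable]: "f \<in> borel_measurable borel"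
    using f by simp
  let ?K = "\<lambda>t x. f (t + x) * cnj (f t) * cis (\<eta> * x)"
  have K: "integrable (lborel \<Otimes>\<^sub>M lborel) (\<lambda>(t, x). ?K t x)"
    by (rule Bochner_Integration.integrable_bound[OF integrable_autocorr_kernel[OF f]])
      (auto simp: norm_mult)
  have inner: "(LINT x|lborel. ?K t x) = cnj (f t * cis (\<eta> * t)) * fourier f \<eta>" for t
  proof -
    have "(LINT x|lborel. ?K t x) =
        (LINT x|lborel. cnj (f t * cis (\<eta> * t)) * (f (t + x) * cis (\<eta> * (t + x))))"
      by (intro Bochner_Integration.integral_cong)
        (auto simp: cis_cnj cis_mult algebra_simps)
    also have "\<dots> = cnj (f t * cis (\<eta> * t)) * (LINT x|lborel. f (t + x) * cis (\<eta> * (t + x)))"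
      by simp
    also have "(LINT x|lborel. f (t + x) * cis (\<eta> * (t + x))) = fourier f \<eta>"
      unfolding fourier_def
      using lborel_integral_real_affine[of 1 "\<lambda>x. f x * cis (\<eta> * x)" t] by simp
    finally show ?thesis .
  qed
  have "fourier (autocorr f) \<eta> = (LINT x|lborel. LINT t|lborel. ?K t x)"
    by (simp add: fourier_def autocorr_def)
  also have "\<dots> = (LINT t|lborel. LINT x|lborel. ?K t x)"
    by (rule lborel_pair.Fubini_integral[OF K])
  also have "\<dots> = (LINT t|lborel. cnj (f t * cis (\<eta> * t))) * fourier f \<eta>"
    by (simp add: inner del: complex_cnj_mult)
  also have "(LINT t|lborel. cnj (f t * cis (\<eta> * t))) = cnj (fourier f \<eta>)"
    unfolding fourier_def by (rule Bochner_Integration.integral_cnj)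
  finally show ?thesis
    by (simp add: complex_norm_square mult.commute del: of_real_power)
qed

lemma autocorr_eq_if_fourier_modulus_eq:
  assumes f: "integrable lborel f" and g: "integrable lborel g"
    and eq: "\<And>\<eta>. cmod (fourier f \<eta>) = cmod (fourier g \<eta>)"
  shows "AE x in lborel. autocorr f x = autocorr g x"
proof -
  have "AE x in lborel. autocorr f x - autocorr g x = 0"
  proof (rule fourier_injective)
    show "integrable lborel (\<lambda>x. autocorr f x - autocorr g x)"
      using f g by (intro Bochner_Integration.integrable_diff integrable_autocorr)
    fix \<eta>
    have "fourier (\<lambda>x. autocorr f x - autocorr g x) \<eta> = fourier (autocorr f) \<eta> - fourier (autocorr g) \<eta>"
      using f g by (simp add: fourier_def left_diff_distrib integrable_mult_cis integrable_autocorr)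
    then show "fourier (\<lambda>x. autocorr f x - autocorr g x) \<eta> = 0"
      by (simp add: fourier_autocorr f g eq)
  qed
  then show ?thesis by simp
qed


section \<open>Recovering coefficients\<close>

lemma infinite_if_AE_lborel:
  assumes "AE x in lborel. P x" and "l < (r :: real)"
  shows "infinite {x \<in> {l<..<r}. P x}"
proof
  assume "finite {x \<in> {l<..<r}. P x}"
  then have "AE x in lborel. x \<notin> {x \<in> {l<..<r}. P x}"
    by (intro AE_not_in finite_imp_null_set_lborel)
  with assms(1) have "AE x in lborel. x \<notin> {l<..<r}"
    by eventually_elim auto
  then have "{l<..<r} \<in> null_sets lborel"
    by (subst AE_iff_null_sets) auto
  with assms(2) show False
    by (auto simp: null_sets_def)
qed

text \<open>Multiplying by a power of \<open>z\<close> that clears the negative exponents leaves a polynomial with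
  infinitely many roots.\<close>

lemma Laurent_polynomial_zero:
  fixes d :: "int \<Rightarrow> complex"
  assumes K: "finite K" and Z: "infinite Z" "0 \<notin> Z"
    and zero: "\<And>z. z \<in> Z \<Longrightarrow> (\<Sum>k\<in>K. d k * z powi k) = 0"
    and k: "k \<in> K"
  shows "d k = 0"
proof -
  define N where "N = Min K"
  have N: "N \<le> j" if "j \<in> K" for j
    using K that by (simp add: N_def)
  define P where "P = (\<Sum>j\<in>K. monom (d j) (nat (j - N)))"
  have "poly P z = 0" if "z \<in> Z" for z
  proof -
    have z: "z \<noteq> 0" using that Z by auto
    have "poly P z = (\<Sum>j\<in>K. z powi (- N) * (d j * z powi j))"
      unfolding P_def poly_sum
    proof (rule sum.cong)
      fix j assume "j \<in> K"
      then have "z ^ nat (j - N) = z powi (j - N)"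
        using N by (simp add: power_int_def)
      also have "\<dots> = z powi (- N) * z powi j"
        using z by (simp flip: power_int_add)
      finally show "poly (monom (d j) (nat (j - N))) z = z powi (- N) * (d j * z powi j)"
        by (simp add: poly_monom)
    qed simp
    also have "\<dots> = 0"
      using zero[OF that] by (simp flip: sum_distrib_left)
    finally show ?thesis .
  qed
  then have "Z \<subseteq> {z. poly P z = 0}" by auto
  then have "P = 0"
    using Z(1) poly_roots_finite finite_subset by blast
  moreover have "coeff P (nat (k - N)) = (\<Sum>j\<in>K. if j = k then d j else 0)"
    unfolding P_def coeff_sum using N k by (intro sum.cong) (auto simp: nat_eq_iff)
  ultimately show ?thesis
    using K k by simp
qed

text \<open>The diagonal products give the moduli; one index \<open>l\<close> with \<open>p l \<noteq> 0\<close> then serves as a phase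
  reference for all the others.\<close>

lemma eq_up_to_phase_if_correlations_eq:
  fixes p q :: "'i \<Rightarrow> complex"
  assumes eq: "\<And>j k. p j * cnj (p k) = q j * cnj (q k)"
  shows "\<exists>c. cmod c = 1 \<and> (\<forall>k. q k = c * p k)"
proof -
  have modulus: "cmod (p k) = cmod (q k)" for k
    using arg_cong[OF eq[of k k], of cmod] by (simp add: norm_mult flip: power2_eq_square)
  show ?thesis
  proof (cases "\<exists>k. p k \<noteq> 0")
    case True
    then obtain l where l: "p l \<noteq> 0" by blast
    with modulus[of l] have "q l \<noteq> 0" by (metis norm_eq_zero)
    have "q k = cnj (p l) / cnj (q l) * p k" for k
      using eq[of k l] \<open>q l \<noteq> 0\<close> by (simp add: field_simps)
    moreover have "cmod (cnj (p l) / cnj (q l)) = 1"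
      using modulus[of l] \<open>q l \<noteq> 0\<close> by (simp add: norm_divide)
    ultimately show ?thesis by blast
  next
    case False
    with modulus have "q k = 1 * p k" for k
      by (metis mult_1 norm_eq_zero)
    then show ?thesis
      by (metis norm_one)
  qed
qed

section \<open>Pulse trains\<close>

text \<open>The cells \<open>[a * j, a * j + a)\<close> partition the line, and an interval starting at \<open>a * k\<close> and not
  longer than \<open>a\<close> stays in the \<open>k\<close>-th one.\<close>

lemma indicator_on_cell:
  fixes a w y :: real
  assumes a: "0 < a" and w: "w \<le> a" and y: "a * of_int j \<le> y" "y < a * of_int j + a"
  shows "indicator {a * of_int k..<a * of_int k + w} y =
    (if k = j \<and> y < a * of_int j + w then 1 else 0 :: complex)"
proof (cases k j rule: linorder_cases)
  case less
  then have "a * of_int (k + 1) \<le> a * of_int j"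
    using a by (intro mult_left_mono) linarith+
  with less y w show ?thesis
    by (auto simp: indicator_def ring_distribs)
next
  case greater
  then have "a * of_int (j + 1) \<le> a * of_int k"
    using a by (intro mult_left_mono) linarith+
  with greater y show ?thesis
    by (auto simp: indicator_def ring_distribs)
qed (use y in \<open>auto simp: indicator_def\<close>)

lemma pulse_train_on_cell:
  assumes "finite {k. s k \<noteq> 0}" and a: "0 < a" and b: "b \<le> a"
    and y: "a * of_int j \<le> y" "y < a * of_int j + a"
  shows "pulse_train a b s y = (if y < a * of_int j + b then s j else 0)"
proof -
  have "pulse_train a b s y = (\<Sum>k | s k \<noteq> 0. if j = k then (if y < a * of_int j + b then s k else 0) else 0)"
    unfolding pulse_train_def using a b y by (intro sum.cong) (auto simp: indicator_on_cell)
  then show ?thesis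
    using assms(1) by (simp add: sum.delta)
qed

lemma emeasure_lborel_Ico_eq: "emeasure lborel {l..<r} = ennreal (if l \<le> r then r - l else 0)"
  by (cases "l \<le> r") auto

lemma integrable_indicator_interval:
  "integrable lborel (indicator {l..<r} :: real \<Rightarrow> complex)"
proof -
  have "integrable lborel (\<lambda>t::real. indicator {l..<r} t *\<^sub>R (1 :: complex))"
    by (intro integrable_scaleR_left integrable_real_indicator) (auto simp: emeasure_lborel_Ico_eq)
  also have "(\<lambda>t. indicator {l..<r} t *\<^sub>R (1 :: complex)) = indicator {l..<r}"
    by (auto simp: indicator_def)
  finally show ?thesis .
qed

lemma integrable_pulse_train: "integrable lborel (pulse_train a b s)"
  unfolding pulse_train_def
  by (intro Bochner_Integration.integrable_sum integrable_mult_right integrable_indicator_interval)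

text \<open>If \<open>t\<close> lies in the pulse starting at \<open>a * k\<close>, then \<open>t + a * m + s\<close> lies in the cell of index
  \<open>k + m\<close>, because \<open>b + s < a\<close>; it lies in the pulse there exactly if \<open>t\<close> is not among the last
  \<open>s\<close> units of its own pulse.\<close>

lemma pulse_train_product:
  fixes m :: int
  assumes fin: "finite {k. p k \<noteq> 0}" and K: "finite K" "{k. p k \<noteq> 0} \<subseteq> K"
    and b: "b < a / 2" and s: "0 < s" "s < b"
  shows "pulse_train a b p (t + (a * of_int m + s)) * cnj (pulse_train a b p t) =
    (\<Sum>k\<in>K. p (k + m) * cnj (p k) * indicator {a * of_int k..<a * of_int k + (b - s)} t)"
proof -
  have a: "a > 0" "b \<le> a" using b s by auto
  define j where "j = \<lfloor>t / a\<rfloor>"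
  have "of_int j \<le> t / a" "t / a < of_int j + 1"
    unfolding j_def by linarith+
  then have t: "a * of_int j \<le> t" "t < a * of_int j + a"
    using a by (simp_all add: field_simps)
  have "pulse_train a b p (t + (a * of_int m + s)) * cnj (pulse_train a b p t) =
    (if t < a * of_int j + (b - s) then p (j + m) * cnj (p j) else 0)"
  proof (cases "t < a * of_int j + b")
    case True
    have "pulse_train a b p (t + (a * of_int m + s)) = 
      (if t + (a * of_int m + s) < a * of_int (j + m) + b then p (j + m) else 0)"
      using True t s b a by (intro pulse_train_on_cell fin) (auto simp: ring_distribs)
    moreover have "pulse_train a b p t = p j"
      using True t a fin by (simp add: pulse_train_on_cell)
    ultimately show ?thesis
      by (auto simp: ring_distribs)
  next
    case False
    then have "pulse_train a b p t = 0"
      using t a fin by (simp add: pulse_train_on_cell)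
    with False s show ?thesis by simp
  qed
  also have "\<dots> = (\<Sum>k\<in>K. if j = k then (if t < a * of_int j + (b - s) then p (k + m) * cnj (p k) else 0) else 0)"
    using K by (auto simp: sum.delta)
  also have "\<dots> = (\<Sum>k\<in>K. p (k + m) * cnj (p k) * indicator {a * of_int k..<a * of_int k + (b - s)} t)"
    using a b s t by (intro sum.cong) (auto simp: indicator_on_cell)
  finally show ?thesis .
qed

section \<open>Chirped signals and the fractional Fourier transform\<close>

definition chirp :: "real \<Rightarrow> (real \<Rightarrow> complex) \<Rightarrow> real \<Rightarrow> complex" where
  "chirp \<kappa> f t = f t * cis (- \<kappa> * t\<^sup>2)"

lemma integrable_chirp: "integrable lborel f \<Longrightarrow> integrable lborel (chirp \<kappa> f)"
  unfolding chirp_def by (rule integrable_mult_cis) measurable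

lemma cmod_frft:
  "cmod (frft \<alpha> f \<xi>) =
    cmod (frft_const \<alpha>) * cmod (fourier (chirp (pi * cot \<alpha>) f) (- 2 * pi * \<xi> / sin \<alpha>))"
proof -
  have "(LINT t|lborel. f t * exp (- \<i> * complex_of_real (pi * t\<^sup>2 * cot \<alpha>))
      * exp (- 2 * \<i> * complex_of_real (pi * t * \<xi> / sin \<alpha>))) =
    fourier (chirp (pi * cot \<alpha>) f) (- 2 * pi * \<xi> / sin \<alpha>)"
    unfolding fourier_def chirp_def cis_conv_exp
    by (intro Bochner_Integration.integral_cong) (auto simp: algebra_simps)
  moreover have "cmod (exp (- \<i> * complex_of_real r)) = 1" for r
    by (metis norm_cis cis_conv_exp mult_minus_left mult_minus_right of_real_minus)
  ultimately show ?thesis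
    unfolding frft_def norm_mult by simp
qed

text \<open>The chirp multiplies the integrand by \<open>cis (- \<kappa> * x\<^sup>2) * cis (- 2 * \<kappa> * x * t)\<close>. Its dependence
  on \<open>t\<close> separates the pulses: moving the \<open>k\<close>-th overlap interval to the origin costs the
  \<open>k\<close>-th power of \<open>cis (- 2 * \<kappa> * a * x)\<close> and leaves an integral that depends neither on \<open>k\<close> nor
  on \<open>p\<close>. The set \<open>K\<close> may be larger than the support of \<open>p\<close>, so that two pulse trains can be
  expanded over the same indices.\<close>

lemma autocorr_chirped_pulse_train:
  fixes m :: int
  assumes fin: "finite {k. p k \<noteq> 0}" and K: "finite K" "{k. p k \<noteq> 0} \<subseteq> K"
    and b: "b < a / 2" and s: "0 < s" "s < b" and x: "x = a * of_int m + s"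
  shows "autocorr (chirp \<kappa> (pulse_train a b p)) x =
    cis (- \<kappa> * x\<^sup>2) * fourier (indicator {0..<b - s}) (- 2 * \<kappa> * x) *
    (\<Sum>k\<in>K. p (k + m) * cnj (p k) * cis (- 2 * \<kappa> * a * x) powi k)"
proof -
  let ?I = "\<lambda>k t. indicator {a * of_int k..<a * of_int k + (b - s)} t * cis (- 2 * \<kappa> * x * t)"
  have "chirp \<kappa> (pulse_train a b p) (t + x) * cnj (chirp \<kappa> (pulse_train a b p) t) =
      (\<Sum>k\<in>K. cis (- \<kappa> * x\<^sup>2) * (p (k + m) * cnj (p k)) * ?I k t)" for t
  proof -
    have "cis (- \<kappa> * (t + x)\<^sup>2) * cnj (cis (- \<kappa> * t\<^sup>2)) = cis (- \<kappa> * x\<^sup>2) * cis (- 2 * \<kappa> * x * t)"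
      by (simp add: cis_cnj cis_mult power2_eq_square algebra_simps)
    then have "chirp \<kappa> (pulse_train a b p) (t + x) * cnj (chirp \<kappa> (pulse_train a b p) t) =
      (pulse_train a b p (t + x) * cnj (pulse_train a b p t)) * (cis (- \<kappa> * x\<^sup>2) * cis (- 2 * \<kappa> * x * t))"
      by (simp add: chirp_def mult.assoc mult.left_commute)
    then show ?thesis
      unfolding x pulse_train_product[OF fin K b s] sum_distrib_right by (simp add: mult_ac)
  qed
  moreover have int: "integrable lborel (?I k)" for k
    by (intro integrable_mult_cis integrable_indicator_interval) auto
  ultimately have "autocorr (chirp \<kappa> (pulse_train a b p)) x =
      (\<Sum>k\<in>K. cis (- \<kappa> * x\<^sup>2) * (p (k + m) * cnj (p k)) * (LINT t|lborel. ?I k t))"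
    by (simp add: autocorr_def)
  moreover have "(LINT t|lborel. ?I k t) =
      cis (- 2 * \<kappa> * a * x) powi k * fourier (indicator {0..<b - s}) (- 2 * \<kappa> * x)" for k
  proof -
    have "(LINT t|lborel. ?I k t) = (LINT t|lborel. ?I k (a * of_int k + t))"
      using lborel_integral_real_affine[of 1 "?I k" "a * of_int k"] by simp
    also have "\<dots> = (LINT t|lborel. cis (- 2 * \<kappa> * a * x) powi k * (indicator {0..<b - s} t * cis (- 2 * \<kappa> * x * t)))"
      by (intro Bochner_Integration.integral_cong)
        (auto simp: indicator_def cis_power_int cis_mult algebra_simps)
    finally show ?thesis
      by (simp add: fourier_def)
  qed
  ultimately show ?thesis
    by (simp add: sum_distrib_left mult_ac)
qed

text \<open>On so short an interval the integrand stays in the open right half plane.\<close>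

lemma fourier_short_interval_nonzero:
  assumes L: "0 < L" and \<omega>: "\<bar>\<omega>\<bar> * L \<le> 1"
  shows "fourier (indicator {0..<L}) \<omega> \<noteq> 0"
proof -
  have int: "integrable lborel (\<lambda>t. indicator {0..<L} t * cis (\<omega> * t))"
    by (intro integrable_mult_cis integrable_indicator_interval) auto
  have "0 < L * cos 1"
    using L cos_gt_zero_pi[of 1] pi_gt3 by simp
  also have "L * cos 1 = (LINT t|lborel. indicator {0..<L} t * cos 1)"
    using L by (simp add: measure_def emeasure_lborel_Ico_eq)
  also have "\<dots> \<le> (LINT t|lborel. Re (indicator {0..<L} t * cis (\<omega> * t)))"
  proof (rule integral_mono)
    show "integrable lborel (\<lambda>t. indicator {0..<L} t * cos (1::real))"
      by (intro integrable_mult_left integrable_real_indicator) (auto simp: emeasure_lborel_Ico_eq)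
    show "integrable lborel (\<lambda>t. Re (indicator {0..<L} t * cis (\<omega> * t)))"
      using int by (rule integrable_Re)
    fix t :: real
    have "cos 1 \<le> cos (\<omega> * t)" if "0 \<le> t" "t < L"
    proof -
      have "\<bar>\<omega> * t\<bar> \<le> \<bar>\<omega>\<bar> * L"
        using that by (simp add: abs_mult mult_left_mono)
      then have "cos 1 \<le> cos \<bar>\<omega> * t\<bar>"
        using \<omega> pi_gt3 by (intro cos_monotone_0_pi_le) auto
      then show ?thesis by (simp only: cos_abs_real)
    qed
    then show "indicator {0..<L} t * cos 1 \<le> Re (indicator {0..<L} t * cis (\<omega> * t))"
      by (auto simp: indicator_def)
  qed
  also have "\<dots> = Re (fourier (indicator {0..<L}) \<omega>)"
    unfolding fourier_def using int by (rule integral_Re)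
  finally show ?thesis by auto
qed

text \<open>The lag runs through a short interval just below \<open>a * m + b\<close>. Its length \<open>\<delta>\<close> is chosen so small
  that the common factor of the two autocorrelations does not vanish there and that
  \<open>x \<mapsto> cis (- 2 * \<kappa> * a * x)\<close> is injective there. Then the difference of the two Laurent polynomials
  has infinitely many zeros.\<close>

lemma coefficient_correlations_eq:
  assumes fin: "finite {k. p k \<noteq> 0}" "finite {k. q k \<noteq> 0}"
    and b: "0 < b" "b < a / 2" and \<kappa>: "\<kappa> \<noteq> 0"
    and eq: "AE x in lborel. autocorr (chirp \<kappa> (pulse_train a b q)) x =
      autocorr (chirp \<kappa> (pulse_train a b p)) x"
  shows "p (k + m) * cnj (p k) = q (k + m) * cnj (q k)"
proof -
  have a: "a > 0" using b by simp
  define K where "K = insert k ({k. p k \<noteq> 0} \<union> {k. q k \<noteq> 0})"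
  have K: "finite K" "{k. p k \<noteq> 0} \<subseteq> K" "{k. q k \<noteq> 0} \<subseteq> K" "k \<in> K"
    using fin by (auto simp: K_def)
  \<comment> \<open>\<open>R\<close> bounds two angular speeds: \<open>2 * \<bar>\<kappa>\<bar> * \<bar>x\<bar>\<close> of the common factor and \<open>2 * \<bar>\<kappa>\<bar> * a\<close> of \<open>z\<close>.\<close>
  define R where "R = 1 + 2 * \<bar>\<kappa>\<bar> * (a * \<bar>of_int m\<bar> + a)"
  have R: "R > 0"
    unfolding R_def using a by (intro add_pos_nonneg) auto
  define \<delta> where "\<delta> = min b (1 / R)"
  have \<delta>: "\<delta> > 0" "\<delta> \<le> b" "R * \<delta> \<le> 1"
    using R b by (auto simp: \<delta>_def min_def field_simps)
  define S where "S = {x \<in> {a * of_int m + b - \<delta><..<a * of_int m + b}.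
    autocorr (chirp \<kappa> (pulse_train a b q)) x = autocorr (chirp \<kappa> (pulse_train a b p)) x}"
  have S: "infinite S"
    unfolding S_def using eq \<delta> by (intro infinite_if_AE_lborel) auto
  define z where "z = (\<lambda>x. cis (- 2 * \<kappa> * a * x))"
  have "inj_on z S"
  proof (rule inj_onI)
    fix x y assume xy: "x \<in> S" "y \<in> S" "z x = z y"
    have "cis (- 2 * \<kappa> * a * (x - y)) = z x * cnj (z y)"
      by (simp add: z_def cis_cnj cis_mult algebra_simps)
    also have "\<dots> = 1"
      by (simp add: xy(3)) (simp add: z_def cis_cnj cis_mult)
    finally have "sin (- 2 * \<kappa> * a * (x - y)) = 0"
      by (simp add: complex_eq_iff)
    moreover have "\<bar>- 2 * \<kappa> * a * (x - y)\<bar> < pi"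
    proof -
      have "\<bar>- 2 * \<kappa> * a * (x - y)\<bar> = (2 * \<bar>\<kappa>\<bar> * a) * \<bar>x - y\<bar>"
        using a by (simp add: abs_mult)
      also have "\<dots> \<le> R * \<delta>"
      proof (rule mult_mono)
        show "2 * \<bar>\<kappa>\<bar> * a \<le> R"
          unfolding R_def using a by (simp add: ring_distribs)
        show "\<bar>x - y\<bar> \<le> \<delta>"
          using xy by (auto simp: S_def)
      qed (use R in auto)
      finally show ?thesis
        using \<delta> pi_gt3 by linarith
    qed
    ultimately have "- 2 * \<kappa> * a * (x - y) = 0"
      using sin_eq_0_pi unfolding abs_less_iff by (metis minus_less_iff)
    with \<kappa> a show "x = y" by simp
  qed
  with S have "infinite (z ` S)"
    by (simp add: finite_image_iff)
  moreover have "0 \<notin> z ` S"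
    by (auto simp: z_def)
  moreover have "(\<Sum>k\<in>K. (p (k + m) * cnj (p k) - q (k + m) * cnj (q k)) * w powi k) = 0"
    if "w \<in> z ` S" for w
  proof -
    obtain x where x: "x \<in> S" and w: "w = z x"
      using \<open>w \<in> z ` S\<close> by blast
    define s where "s = x - a * of_int m"
    have s: "0 < s" "s < b" "x = a * of_int m + s" "b - s \<le> \<delta>"
      using x \<delta> by (auto simp: s_def S_def)
    let ?F = "cis (- \<kappa> * x\<^sup>2) * fourier (indicator {0..<b - s}) (- 2 * \<kappa> * x)"
    have "\<bar>- 2 * \<kappa> * x\<bar> * (b - s) \<le> R * \<delta>"
    proof (rule mult_mono)
      have "\<bar>x\<bar> \<le> \<bar>a * of_int m\<bar> + \<bar>s\<bar>"
        unfolding s(3) by (rule abs_triangle_ineq)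
      also have "\<dots> \<le> a * \<bar>of_int m\<bar> + a"
        using a s b by (simp add: abs_mult)
      finally have "2 * \<bar>\<kappa>\<bar> * \<bar>x\<bar> \<le> 2 * \<bar>\<kappa>\<bar> * (a * \<bar>of_int m\<bar> + a)"
        by (intro mult_left_mono) auto
      then show "\<bar>- 2 * \<kappa> * x\<bar> \<le> R"
        by (simp add: R_def abs_mult)
    qed (use R s in auto)
    then have "fourier (indicator {0..<b - s}) (- 2 * \<kappa> * x) \<noteq> 0"
      using \<delta> s by (intro fourier_short_interval_nonzero) auto
    then have "?F \<noteq> 0" by simp
    moreover have "?F * (\<Sum>k\<in>K. q (k + m) * cnj (q k) * w powi k) =
        ?F * (\<Sum>k\<in>K. p (k + m) * cnj (p k) * w powi k)"
      using x autocorr_chirped_pulse_train[OF fin(1) K(1,2) b(2) s(1-3), of \<kappa>]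
        autocorr_chirped_pulse_train[OF fin(2) K(1,3) b(2) s(1-3), of \<kappa>]
      by (simp add: S_def w z_def)
    ultimately show ?thesis
      by (simp add: left_diff_distrib sum_subtractf)
  qed
  ultimately have "p (k + m) * cnj (p k) - q (k + m) * cnj (q k) = 0"
    using K by (intro Laurent_polynomial_zero[of K "z ` S"
          "\<lambda>k. p (k + m) * cnj (p k) - q (k + m) * cnj (q k)" k]) auto
  then show ?thesis by simp
qed

lemma pulse_train_scale:
  assumes "c \<noteq> 0"
  shows "pulse_train a b (\<lambda>k. c * s k) x = c * pulse_train a b s x"
  using assms by (simp add: pulse_train_def sum_distrib_left mult.assoc)

theorem theorem5p10:
  fixes a b \<alpha> :: real
    and p q :: "int \<Rightarrow> complex"
    and u v :: "real \<Rightarrow> complex"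
  assumes "a > 0" and "b < a / 2"
    and "finite {k. p k \<noteq> 0}" and "finite {k. q k \<noteq> 0}"
    and "u = pulse_train a b p" and "v = pulse_train a b q"
    and "\<forall>m::int. \<alpha> \<noteq> of_int m * (pi / 2)"
    and "\<forall>\<xi>. cmod (frft \<alpha> v \<xi>) = cmod (frft \<alpha> u \<xi>)"
  shows "\<exists>c::complex. cmod c = 1 \<and> (\<forall>x. v x = c * u x)"
proof (cases "b > 0")
  case False
  \<comment> \<open>The pulses are empty.\<close>
  then have "u x = 0" "v x = 0" for x
    by (auto simp: assms(5,6) pulse_train_def)
  then show ?thesis
    by (intro exI[of _ 1]) simp
next
  case True
  define \<kappa> where "\<kappa> = pi * cot \<alpha>"
  have sin: "sin \<alpha> \<noteq> 0"
  proof
    assume "sin \<alpha> = 0"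
    then obtain m :: int where "\<alpha> = of_int m * pi"
      by (auto simp: sin_zero_iff_int2)
    with assms(7)[rule_format, of "2 * m"] show False by simp
  qed
  have cos: "cos \<alpha> \<noteq> 0"
  proof
    assume "cos \<alpha> = 0"
    then obtain m :: int where "\<alpha> = of_int m * (pi / 2)"
      by (auto simp: cos_zero_iff_int)
    with assms(7) show False by blast
  qed
  have \<kappa>: "\<kappa> \<noteq> 0"
    using sin cos by (simp add: \<kappa>_def cot_def)
  have const: "frft_const \<alpha> \<noteq> 0"
    using sin by (simp add: frft_const_def)
  have "cmod (fourier (chirp \<kappa> v) \<eta>) = cmod (fourier (chirp \<kappa> u) \<eta>)" for \<eta>
  proof -
    have "\<eta> = - 2 * pi * (- \<eta> * sin \<alpha> / (2 * pi)) / sin \<alpha>"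
      using sin by simp
    then show ?thesis
      using assms(8)[rule_format, of "- \<eta> * sin \<alpha> / (2 * pi)"] const
      by (simp add: cmod_frft \<kappa>_def)
  qed
  then have "AE x in lborel. autocorr (chirp \<kappa> v) x = autocorr (chirp \<kappa> u) x"
    by (intro autocorr_eq_if_fourier_modulus_eq integrable_chirp)
      (auto simp: assms(5,6) integrable_pulse_train)
  then have "p (k + m) * cnj (p k) = q (k + m) * cnj (q k)" for k m
    unfolding assms(5,6) using assms(2-4) True \<kappa> by (intro coefficient_correlations_eq)
  from this[where m = "j - k" and k = k for j k]
  have "p j * cnj (p k) = q j * cnj (q k)" for j k
    by simp
  then obtain c where c: "cmod c = 1" "\<And>k. q k = c * p k"
    using eq_up_to_phase_if_correlations_eq[of p q] by blast
  then have "v = pulse_train a b (\<lambda>k. c * p k)"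
    by (simp add: assms(6) flip: c(2))
  moreover have "c \<noteq> 0"
    using c(1) by auto
  ultimately have "v x = c * u x" for x
    by (simp add: assms(5) pulse_train_scale)
  with c(1) show ?thesis by blast
qed

end
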